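(* Let $h$, $m$ and $s$ be positive integers with $s \leq m$. Let $G$ be an additive abelian group. Then $$\rho_{\pm}^{(s)} (G, m, h) \geq \min (p(G), 2hm - hs - h + 1).$$ Equality holds in this inequality if and only if $m \leq \dfrac{s + p(G)}{2}$.
   Context: For a nonempty finite subset $A=\{a_1,\dots,a_k\}$ (with $|A|=k$) of an additive abelian group $G$ and a nonnegative integer $h$, the $h$-fold signed sumset is $h_{\pm}A=\{\sum_{i=1}^k\lambda_i a_i:\lambda_i\in\mathbb{Z}\cap[-h,h],\ \sum_{i=1}^k|\lambda_i|=h\}$. Write $-A=\{-a:a\in A\}$. Define $$\rho_{\pm}^{(s)}(G,m,h)=\min\{|h_{\pm}A|:A\subseteq G,\ |A|=m,\ |A\cap(-A)|=s\}.$$ The minimum is understood to be over a nonempty family, i.e. the parameters are such that at least one such $A$ exists. The group $G$ need not be finite. $p(G)$ denotes the order of the smallest nontrivial subgroup of $G$, or $\infty$ if no such (finite) subgroup exists; inequalities involving $\infty$ are read in the usual way. *)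

theory Defs
  imports "HOL-Algebra.Coset" "HOL-Algebra.FiniteProduct" "HOL-Library.Extended_Real"
begin

text \<open>
  An abelian group is a \<^locale>\<open>comm_group\<close>, hence written multiplicatively: the sum
  of the \<open>\<lambda>\<^sub>i a\<^sub>i\<close> becomes the product of the \<open>a\<^sub>i [^] \<lambda>\<^sub>i\<close>, and \<open>-A\<close> becomes \<open>set_inv A\<close>.
\<close>

definition signed_sumset :: "('a, 'b) monoid_scheme \<Rightarrow> nat \<Rightarrow> 'a set \<Rightarrow> 'a set" where
  "signed_sumset G h A =
     {finprod G (\<lambda>a. a [^]\<^bsub>G\<^esub> l a) A | l :: 'a \<Rightarrow> int.
        (\<forall>a\<in>A. l a \<in> {- int h..int h}) \<and> (\<Sum>a\<in>A. \<bar>l a\<bar>) = int h}"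

definition admissible_sets :: "('a, 'b) monoid_scheme \<Rightarrow> nat \<Rightarrow> nat \<Rightarrow> 'a set set" where
  "admissible_sets G m s =
     {A. A \<subseteq> carrier G \<and> A \<noteq> {} \<and> finite A \<and> card A = m \<and> card (A \<inter> set_inv\<^bsub>G\<^esub> A) = s}"

text \<open>
  The infimum of a nonempty set of naturals is its minimum; for an empty family the value
  is the junk value 0.
\<close>

definition rho_signed :: "('a, 'b) monoid_scheme \<Rightarrow> nat \<Rightarrow> nat \<Rightarrow> nat \<Rightarrow> nat" where
  "rho_signed G s m h = (INF A\<in>admissible_sets G m s. card (signed_sumset G h A))"

text \<open>In \<^typ>\<open>enat\<close> the infimum of the empty set is \<open>\<infinity>\<close>.\<close>

definition min_subgroup_order :: "('a, 'b) monoid_scheme \<Rightarrow> enat" where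
  "min_subgroup_order G =
     (INF H\<in>{H. subgroup H G \<and> finite H \<and> H \<noteq> {\<one>\<^bsub>G\<^esub>}}. enat (card H))"

end

theory Submission
  imports Defs "HOL-Algebra.Elementary_Groups"
begin

text \<open>
  Write \<open>S\<close> for the union of \<open>A\<close> and its inverse, so that \<open>|S| = 2m - s\<close>. A signed sumset only ever
  multiplies elements of \<open>S\<close>, and since \<open>s > 0\<close> it contains the full \<open>h\<close>-fold product set of \<open>S\<close>:
  cancellation inside a product of \<open>h\<close> elements of \<open>S\<close> lowers the total weight of the exponents by an
  even amount, and an element \<open>b\<close> with \<open>b\<close> and \<open>inv b\<close> both in \<open>A\<close> can absorb that surplus weight
  without changing the product (\<open>signed_sumset_pad\<close>).

  The lower bound is therefore the Cauchy--Davenport inequality for abelian groups, in which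
  \<open>p(G)\<close> takes the place of the prime, applied \<open>h\<close> times to \<open>S\<close> (\<open>card_iterated_set_mult\<close>):
  \<open>h (|S| - 1) + 1 = 2hm - hs - h + 1\<close>. The same inclusion gives \<open>|S|\<close> itself as a lower bound, so
  equality is impossible once \<open>2m - s > p(G)\<close>.

  Conversely let \<open>n = 2m - s \<le> p(G)\<close>. A symmetric progression \<open>g\<^sup>-\<^sup>N, g\<^sup>2\<^sup>-\<^sup>N, \<dots>, g\<^sup>N\<close> with
  \<open>N = n - 1\<close> is preserved by inversion, which reverses its order. Its first \<open>m\<close> terms meet their
  inverses, the last \<open>m\<close> terms, in exactly \<open>2m - n = s\<close> elements; and their signed sumset lies in
  the progression from \<open>g\<^sup>-\<^sup>h\<^sup>N\<close> to \<open>g\<^sup>h\<^sup>N\<close>, which has \<open>hN + 1\<close> terms, as well as in any subgroup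
  containing \<open>g\<close>. The step \<open>2\<close> in the exponent treats even and odd \<open>n\<close> alike, but for \<open>n > 1\<close> the
  terms are distinct only if \<open>g\<close> is not an involution, so the case \<open>p(G) = 2\<close>, \<open>n = 2\<close> is separate: there
  \<open>A\<close> is a subgroup of order \<open>2\<close>.
\<close>

section \<open>The order of the smallest nontrivial subgroup\<close>

lemma min_subgroup_order_le:
  assumes "subgroup H G" "finite H" "H \<noteq> {\<one>\<^bsub>G\<^esub>}"
  shows "min_subgroup_order G \<le> enat (card H)"
  unfolding min_subgroup_order_def by (rule INF_lower) (use assms in auto)

lemma min_subgroup_order_attained:
  assumes "min_subgroup_order G \<noteq> \<infinity>"
  obtains H where "subgroup H G" "finite H" "H \<noteq> {\<one>\<^bsub>G\<^esub>}" "min_subgroup_order G = enat (card H)"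
proof -
  let ?K = "(\<lambda>H. enat (card H)) ` {H. subgroup H G \<and> finite H \<and> H \<noteq> {\<one>\<^bsub>G\<^esub>}}"
  have "?K \<noteq> {}"
    using assms unfolding min_subgroup_order_def by (metis Inf_enat_def)
  then have "Inf ?K \<in> ?K"
    unfolding Inf_enat_def by (metis (no_types, lifting) LeastI ex_in_conv)
  then show thesis
    using that unfolding min_subgroup_order_def by blast
qed

lemma (in group) two_le_min_subgroup_order: "2 \<le> min_subgroup_order G"
  unfolding min_subgroup_order_def
proof (rule INF_greatest)
  fix H assume H: "H \<in> {H. subgroup H G \<and> finite H \<and> H \<noteq> {\<one>}}"
  then have 1: "\<one> \<in> H" by (simp add: subgroup.one_closed)
  with H obtain x where "x \<in> H" "x \<noteq> \<one>" by blast
  with 1 H have "card {\<one>, x} \<le> card H" by (intro card_mono) auto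
  with \<open>x \<noteq> \<one>\<close> show "2 \<le> enat (card H)"
    by (simp add: numeral_eq_enat)
qed

text \<open>
  The powers of \<open>x\<close> form a nontrivial subgroup, and exponents matter only modulo \<open>j\<close>.
\<close>

lemma (in group) min_subgroup_order_le_exponent:
  assumes x: "x \<in> carrier G" "x \<noteq> \<one>" and j: "0 < j" "x [^] j = \<one>"
  shows "min_subgroup_order G \<le> enat j"
proof -
  let ?H = "range (\<lambda>n::int. x [^] n)"
  have sub: "?H \<subseteq> (\<lambda>i. x [^] int i) ` {..<j}"
  proof safe
    fix n :: int
    have "x [^] n = x [^] (int j * (n div int j) + n mod int j)" by simp
    also have "\<dots> = (x [^] int j) [^] (n div int j) \<otimes> x [^] (n mod int j)"
      using x by (simp only: int_pow_mult int_pow_pow)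
    also have "\<dots> = x [^] (n mod int j)"
      using x j by (simp add: int_pow_int)
    also have "\<dots> = x [^] int (nat (n mod int j))"
      using j by simp
    finally have "x [^] n = x [^] int (nat (n mod int j))" .
    moreover have "nat (n mod int j) < j"
      using j by (simp add: nat_less_iff)
    ultimately show "x [^] n \<in> (\<lambda>i. x [^] int i) ` {..<j}" by blast
  qed
  have "x [^] (1::int) \<in> ?H" by (rule rangeI)
  then have "x \<in> ?H" using x(1) by simp
  then have "?H \<noteq> {\<one>}" using x(2) by blast
  moreover have "finite ?H" using sub finite_surj by blast
  ultimately have "min_subgroup_order G \<le> enat (card ?H)"
    using subgroup_of_powers[OF x(1)] by (intro min_subgroup_order_le)
  also have "card ?H \<le> j"
    using card_mono[OF _ sub] card_image_le[of "{..<j}" "\<lambda>i. x [^] int i"] by simp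
  finally show ?thesis by simp
qed

section \<open>The Cauchy--Davenport inequality\<close>

lemma set_mult_image: "X <#>\<^bsub>G\<^esub> Y = (\<lambda>(x, y). x \<otimes>\<^bsub>G\<^esub> y) ` (X \<times> Y)"
  unfolding set_mult_def by auto

lemma (in comm_group) set_mult_comm:
  assumes "X \<subseteq> carrier G" "Y \<subseteq> carrier G"
  shows "X <#> Y = Y <#> X"
proof -
  have "V <#> W \<subseteq> W <#> V" if "V \<subseteq> carrier G" "W \<subseteq> carrier G" for V W
  proof
    fix z assume "z \<in> V <#> W"
    then obtain v w where "v \<in> V" "w \<in> W" "z = v \<otimes> w" by (auto simp: set_mult_def)
    moreover from this that have "z = w \<otimes> v" by (metis m_comm subsetD)
    ultimately show "z \<in> W <#> V" unfolding set_mult_def by blast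
  qed
  with assms show ?thesis by blast
qed

lemma (in comm_group) card_le_card_set_mult:
  assumes "finite X" "finite Y" "Y \<noteq> {}" "X \<subseteq> carrier G" "Y \<subseteq> carrier G"
  shows "card X \<le> card (X <#> Y)"
proof -
  obtain y where y: "y \<in> Y" using assms by blast
  have "inj_on (\<lambda>x. x \<otimes> y) X"
    using assms y by (intro inj_onI) (metis right_cancel subsetD)
  moreover have "(\<lambda>x. x \<otimes> y) ` X \<subseteq> X <#> Y"
    using y by (auto simp: set_mult_def)
  moreover have "finite (X <#> Y)"
    using assms by (simp add: set_mult_image)
  ultimately show ?thesis by (metis card_inj_on_le)
qed

text \<open>
  Starting from any element of \<open>X\<close>, translation by the powers of \<open>x\<close> never leaves the finite set \<open>X\<close>,
  so two of the first \<open>|X| + 1\<close> powers coincide and \<open>x\<close> has order at most \<open>|X|\<close>.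
\<close>

lemma (in group) min_subgroup_order_le_card_if_translation_stable:
  assumes X: "finite X" "X \<noteq> {}" "X \<subseteq> carrier G"
    and x: "x \<in> carrier G" "x \<noteq> \<one>"
    and stable: "\<And>u. u \<in> X \<Longrightarrow> u \<otimes> x \<in> X"
  shows "min_subgroup_order G \<le> enat (card X)"
proof -
  obtain u where u: "u \<in> X" using X by blast
  then have uG: "u \<in> carrier G" using X by blast
  have orbit: "u \<otimes> x [^] (i::nat) \<in> X" for i
  proof (induction i)
    case (Suc i)
    then show ?case using stable[OF Suc] uG x by (simp add: m_assoc)
  qed (use u uG in simp)
  have "\<not> inj_on (\<lambda>i::nat. u \<otimes> x [^] i) {..card X}"
  proof
    assume "inj_on (\<lambda>i::nat. u \<otimes> x [^] i) {..card X}"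
    then have "card {..card X} \<le> card X"
      by (rule card_inj_on_le) (use orbit X in auto)
    then show False by simp
  qed
  then obtain i j :: nat where ij: "i < j" "j \<le> card X" "u \<otimes> x [^] i = u \<otimes> x [^] j"
  proof -
    from \<open>\<not> inj_on _ _\<close> obtain i j :: nat
      where "i \<le> card X" "j \<le> card X" "u \<otimes> x [^] i = u \<otimes> x [^] j" "i \<noteq> j"
      unfolding inj_on_def by blast
    then show thesis by (metis linorder_neqE_nat that)
  qed
  then have "x [^] i = x [^] j" using uG x by simp
  moreover have "x [^] j = x [^] i \<otimes> x [^] (j - i)"
    using x ij by (simp add: nat_pow_mult)
  ultimately have "x [^] i = x [^] i \<otimes> x [^] (j - i)"
    by (rule trans)
  then have "x [^] (j - i) = \<one>"
    using x by (simp only: l_cancel_one' nat_pow_closed)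
  then have "min_subgroup_order G \<le> enat (j - i)"
    using x ij by (intro min_subgroup_order_le_exponent) auto
  also have "\<dots> \<le> enat (card X)" using ij by simp
  finally show ?thesis .
qed

text \<open>
  The proof uses Dyson's \<open>e\<close>-transform and induction on \<open>|Y|\<close>. For \<open>e\<close> in the group, let \<open>Y'\<close>
  consist of the \<open>y\<close> in \<open>Y\<close> with \<open>e y\<close> in \<open>X\<close>, and move the other translates \<open>e y\<close> into \<open>X\<close>. This keeps
  the sum of the two sizes, and it does not enlarge the product set, because a product
  \<open>(e v) y\<close> with \<open>y\<close> in \<open>Y'\<close> can be read as \<open>(e y) v\<close>. The induction goes through whenever some
  \<open>Y'\<close> is nonempty and different from \<open>Y\<close>. Otherwise any translate of \<open>Y\<close> that meets \<open>X\<close> is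
  contained in \<open>X\<close>; then \<open>X\<close> is stable under every quotient of two elements of \<open>Y\<close>, and
  either \<open>Y\<close> is a singleton or \<open>p(G) \<le> |X|\<close>.
\<close>

theorem (in comm_group) cauchy_davenport:
  assumes "finite X" "finite Y" "X \<noteq> {}" "Y \<noteq> {}" "X \<subseteq> carrier G" "Y \<subseteq> carrier G"
  shows "min (min_subgroup_order G) (enat (card X + card Y - 1)) \<le> enat (card (X <#> Y))"
  using assms
proof (induction "card Y" arbitrary: X Y rule: less_induct)
  case less
  note fin = less.prems(1,2) and ne = less.prems(3,4) and sub = less.prems(5,6)
  have closed: "x \<in> X \<Longrightarrow> x \<in> carrier G" "y \<in> Y \<Longrightarrow> y \<in> carrier G" for x y
    using sub by auto
  show ?case
  proof (cases "\<exists>e\<in>carrier G. {y\<in>Y. e \<otimes> y \<in> X} \<noteq> {} \<and> {y\<in>Y. e \<otimes> y \<in> X} \<noteq> Y")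
    case True
    then obtain e where e: "e \<in> carrier G"
      and proper: "{y\<in>Y. e \<otimes> y \<in> X} \<noteq> {}" "{y\<in>Y. e \<otimes> y \<in> X} \<noteq> Y" by blast
    define Y' where "Y' = {y\<in>Y. e \<otimes> y \<in> X}"
    define Z where "Z = (\<lambda>y. e \<otimes> y) ` (Y - Y')"
    have Y': "Y' \<subset> Y" "Y' \<noteq> {}" using proper by (auto simp: Y'_def)
    have "inj_on (\<lambda>y. e \<otimes> y) (Y - Y')"
      using closed e by (intro inj_onI) auto
    then have "card Z = card Y - card Y'"
      using Y' fin unfolding Z_def by (simp add: card_image card_Diff_subset psubset_imp_subset rev_finite_subset)
    moreover have "X \<inter> Z = {}" by (auto simp: Z_def Y'_def)
    ultimately have "card (X \<union> Z) = card X + (card Y - card Y')"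
      using fin by (simp add: card_Un_disjoint Z_def)
    moreover have "card Y' < card Y" using Y' fin by (simp add: psubset_card_mono)
    ultimately have card: "card (X \<union> Z) + card Y' = card X + card Y" by simp
    have "(X \<union> Z) <#> Y' \<subseteq> X <#> Y"
    proof
      fix z assume "z \<in> (X \<union> Z) <#> Y'"
      then obtain x y where xy: "x \<in> X \<union> Z" "y \<in> Y'" "z = x \<otimes> y"
        by (auto simp: set_mult_def)
      show "z \<in> X <#> Y"
      proof (cases "x \<in> X")
        case True
        with xy Y' show ?thesis by (auto simp: set_mult_def)
      next
        case False
        then obtain v where v: "v \<in> Y" "x = e \<otimes> v" using xy by (auto simp: Z_def)
        have "z = (e \<otimes> y) \<otimes> v"
          using xy v e closed Y' by (simp add: Y'_def m_ac)
        moreover have "e \<otimes> y \<in> X" using xy by (simp add: Y'_def)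
        ultimately show ?thesis using v by (auto simp: set_mult_def)
      qed
    qed
    then have "card ((X \<union> Z) <#> Y') \<le> card (X <#> Y)"
      using fin by (intro card_mono) (auto simp: set_mult_image)
    moreover have "min (min_subgroup_order G) (enat (card (X \<union> Z) + card Y' - 1))
        \<le> enat (card ((X \<union> Z) <#> Y'))"
      using \<open>card Y' < card Y\<close>
      by (rule less.hyps) (use fin ne sub e Y' closed in \<open>auto simp: Z_def intro: finite_subset\<close>)
    ultimately show ?thesis
      unfolding card by (meson enat_ord_simps(1) order_trans)
  next
    case False
    then have stuck: "e \<otimes> y' \<in> X" if "e \<in> carrier G" "y \<in> Y" "y' \<in> Y" "e \<otimes> y \<in> X" for e y y'
      using that by blast
    have grows: "card X \<le> card (X <#> Y)"
      using fin ne sub by (intro card_le_card_set_mult) auto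
    show ?thesis
    proof (cases "\<exists>y\<in>Y. \<exists>y'\<in>Y. y \<noteq> y'")
      case True
      then obtain y y' where y: "y \<in> Y" "y' \<in> Y" "y \<noteq> y'" by blast
      have "min_subgroup_order G \<le> enat (card X)"
      proof (rule min_subgroup_order_le_card_if_translation_stable[where x = "inv y \<otimes> y'"])
        show "inv y \<otimes> y' \<noteq> \<one>"
          using y closed by (metis inv_equality inv_inv inv_closed)
        show "u \<otimes> (inv y \<otimes> y') \<in> X" if "u \<in> X" for u
          using stuck[of "u \<otimes> inv y" y y'] that y closed by (simp add: m_assoc)
      qed (use fin ne sub y closed in auto)
      then show ?thesis
        using grows by (meson enat_ord_simps(1) min.coboundedI1 order_trans)
    next
      case False
      with ne obtain y where "Y = {y}" by blast
      then show ?thesis using grows by (simp add: min.coboundedI2)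
    qed
  qed
qed

section \<open>Iterated product sets\<close>

primrec iterated_set_mult :: "('a, 'b) monoid_scheme \<Rightarrow> 'a set \<Rightarrow> nat \<Rightarrow> 'a set" where
  "iterated_set_mult G S 0 = {\<one>\<^bsub>G\<^esub>}"
| "iterated_set_mult G S (Suc h) = iterated_set_mult G S h <#>\<^bsub>G\<^esub> S"

lemma (in comm_group) iterated_set_mult_basic:
  assumes "finite S" "S \<noteq> {}" "S \<subseteq> carrier G"
  shows "finite (iterated_set_mult G S h)" "iterated_set_mult G S h \<noteq> {}"
    "iterated_set_mult G S h \<subseteq> carrier G"
proof (induction h)
  case (Suc h)
  { case 1 show ?case using Suc assms by (simp add: set_mult_image) }
  { case 2 show ?case using Suc assms by (simp add: set_mult_image) }
  { case 3 show ?case using Suc assms by (simp add: set_mult_closed) }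
qed auto

text \<open>
  Each further factor \<open>S\<close> adds \<open>|S| - 1\<close> elements by the Cauchy--Davenport inequality, unless
  \<open>p(G)\<close> elements are already present, and a product set is never smaller than its factors.
\<close>

lemma (in comm_group) card_iterated_set_mult:
  assumes "finite S" "S \<noteq> {}" "S \<subseteq> carrier G"
  shows "min (min_subgroup_order G) (enat (h * (card S - 1) + 1))
    \<le> enat (card (iterated_set_mult G S h))"
proof (induction h)
  case (Suc h)
  let ?T = "iterated_set_mult G S h"
  note basic = iterated_set_mult_basic[OF assms, of h]
  have S: "card S > 0" using assms by (simp add: card_gt_0_iff)
  have le: "min (min_subgroup_order G) (enat (card ?T + card S - 1)) \<le> enat (card (?T <#> S))"
    using basic assms by (intro cauchy_davenport) auto
  have grow: "enat (card ?T) \<le> enat (card (?T <#> S))"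
    using basic assms by (simp add: card_le_card_set_mult)
  show ?case
  proof (cases "min_subgroup_order G \<le> enat (card ?T)")
    case True
    then have "min_subgroup_order G \<le> enat (card (?T <#> S))" using grow by (rule order_trans)
    then show ?thesis by (simp add: min.coboundedI1)
  next
    case False
    then have "h * (card S - 1) + 1 \<le> card ?T"
      using Suc by (simp add: min_le_iff_disj)
    then have "Suc h * (card S - 1) + 1 \<le> card ?T + card S - 1"
      using S by simp
    then have "enat (Suc h * (card S - 1) + 1) \<le> enat (card ?T + card S - 1)"
      by (simp only: enat_ord_simps)
    then have "min (min_subgroup_order G) (enat (Suc h * (card S - 1) + 1))
        \<le> min (min_subgroup_order G) (enat (card ?T + card S - 1))"
      by (rule min.mono[OF order_refl])
    from order_trans[OF this le] show ?thesis by (simp only: iterated_set_mult.simps)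
  qed
qed (auto simp: one_enat_def min_le_iff_disj)

lemma (in comm_group) card_le_card_iterated_set_mult:
  assumes "finite S" "S \<subseteq> carrier G" "0 < h"
  shows "card S \<le> card (iterated_set_mult G S h)"
proof (cases "S = {}")
  case False
  obtain k where h: "h = Suc k" using assms by (cases h) auto
  note basic = iterated_set_mult_basic[OF assms(1) False assms(2), of k]
  have "card S \<le> card (S <#> iterated_set_mult G S k)"
    using assms basic by (intro card_le_card_set_mult) auto
  also have "S <#> iterated_set_mult G S k = iterated_set_mult G S h"
    using assms basic by (simp add: h set_mult_comm)
  finally show ?thesis .
qed simp

section \<open>Signed sumsets of sets that meet their inverse\<close>

lemma signed_sumsetI:
  assumes "finite A" "(\<Sum>a\<in>A. \<bar>l a\<bar>) = int h"
  shows "finprod G (\<lambda>a. a [^]\<^bsub>G\<^esub> (l a :: int)) A \<in> signed_sumset G h A"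
proof -
  have "\<bar>l a\<bar> \<le> int h" if "a \<in> A" for a
    using member_le_sum[of a A "\<lambda>a. \<bar>l a\<bar>"] that assms by simp
  then show ?thesis
    using assms unfolding signed_sumset_def by (force simp: abs_le_iff)
qed

lemma (in comm_group) finprod_subset_split:
  assumes "finite A" "B \<subseteq> A" "f \<in> A \<rightarrow> carrier G"
  shows "finprod G f A = finprod G f (A - B) \<otimes> finprod G f B"
proof -
  have "finprod G f ((A - B) \<union> B) = finprod G f (A - B) \<otimes> finprod G f B"
    using assms by (intro finprod_Un_disjoint) (auto intro: finite_subset)
  then show ?thesis using assms(2) by (simp add: Un_absorb2)
qed

text \<open>
  This is where a common element of \<open>A\<close> and its inverse is used: it lets the total weight of the
  exponents grow by any even number while the product stays the same. If \<open>b\<close> is its own inverse,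
  then its exponent can be changed by any even amount. Otherwise \<open>b\<close> and \<open>inv b\<close> are different
  elements of \<open>A\<close> whose exponents contribute only through their difference, and two integers with a
  prescribed difference can be given more total absolute value, in steps of \<open>2\<close>.
\<close>

lemma (in comm_group) signed_sumset_pad:
  assumes A: "finite A" "A \<subseteq> carrier G" and b: "b \<in> A" "inv b \<in> A"
    and weight: "(\<Sum>a\<in>A. \<bar>l a\<bar>) + 2 * int j = int h"
  shows "finprod G (\<lambda>a. a [^] (l a :: int)) A \<in> signed_sumset G h A"
proof -
  have bG: "b \<in> carrier G" using A b by blast
  have pow: "(\<lambda>a. a [^] (k a :: int)) \<in> B \<rightarrow> carrier G" if "B \<subseteq> A" for k B
    using A that by auto
  have "\<exists>l'. (\<Sum>a\<in>A. \<bar>l' a\<bar>) = int h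
    \<and> finprod G (\<lambda>a. a [^] (l' a :: int)) A = finprod G (\<lambda>a. a [^] l a) A"
  proof (cases "inv b = b")
    case True
    define d where "d = (if l b \<ge> 0 then 2 * int j else - 2 * int j)"
    define l' where "l' = l(b := l b + d)"
    have "b [^] (2::int) = \<one>"
      using True bG int_pow_mult[OF bG, of 1 1] by (metis int_pow_1 l_inv one_add_one)
    then have "(b [^] (2::int)) [^] k = \<one>" for k :: int by simp
    then have "b [^] (2 * k :: int) = \<one>" for k using bG by (simp add: int_pow_pow)
    moreover have "\<exists>k. d = 2 * k" by (auto simp: d_def intro: exI[of _ "- int j"])
    ultimately have "b [^] d = \<one>" by metis
    then have "finprod G (\<lambda>a. a [^] l' a) A = finprod G (\<lambda>a. a [^] l a) A"
      using pow[of A] bG by (intro finprod_cong') (auto simp: l'_def int_pow_mult)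
    moreover have "(\<Sum>a\<in>A. \<bar>l' a\<bar>) = int h"
    proof -
      have "(\<Sum>a\<in>A. \<bar>l' a\<bar>) = \<bar>l' b\<bar> + (\<Sum>a\<in>A - {b}. \<bar>l' a\<bar>)"
        using A b by (intro sum.remove)
      also have "(\<Sum>a\<in>A - {b}. \<bar>l' a\<bar>) = (\<Sum>a\<in>A - {b}. \<bar>l a\<bar>)"
        by (intro sum.cong) (auto simp: l'_def)
      also have "\<bar>l' b\<bar> = \<bar>l b\<bar> + 2 * int j" by (simp add: l'_def d_def)
      finally show ?thesis
        using weight sum.remove[OF A(1) b(1), of "\<lambda>a. \<bar>l a\<bar>"] by simp
    qed
    ultimately show ?thesis by blast
  next
    case False
    let ?B = "{b, inv b}"
    \<comment> \<open>If the signs agree, both exponents move away from zero; otherwise the whole difference is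
      first put on one of the two elements, which costs no weight.\<close>
    have "\<exists>u v::int. u - v = p - q \<and> \<bar>u\<bar> + \<bar>v\<bar> = \<bar>p\<bar> + \<bar>q\<bar> + 2 * int j" for p q :: int
    proof (cases "(0 \<le> p) = (0 \<le> q)")
      case True
      then show ?thesis
        by (cases "0 \<le> p")
          (rule exI[of _ "p + int j"] exI[of _ "p - int j"],
           rule exI[of _ "q + int j"] exI[of _ "q - int j"], simp)+
    next
      case False
      then show ?thesis
        by (cases "0 \<le> p")
          (rule exI[of _ "p - q + int j"] exI[of _ "int j"],
           rule exI[of _ "int j"] exI[of _ "q - p + int j"], simp)+
    qed
    then obtain u v where uv: "u - v = l b - l (inv b)"
      "\<bar>u\<bar> + \<bar>v\<bar> = \<bar>l b\<bar> + \<bar>l (inv b)\<bar> + 2 * int j" by blast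
    define l' where "l' = l(b := u, inv b := v)"
    have B: "?B \<subseteq> A" using b by simp
    have on_B: "finprod G (\<lambda>a. a [^] (k a :: int)) ?B = b [^] (k b - k (inv b))" for k
      using False bG by (simp add: int_pow_inv int_pow_diff)
    have "finprod G (\<lambda>a. a [^] l' a) ?B = finprod G (\<lambda>a. a [^] l a) ?B"
      using uv False by (simp only: on_B) (simp add: l'_def)
    moreover have "finprod G (\<lambda>a. a [^] l' a) (A - ?B) = finprod G (\<lambda>a. a [^] l a) (A - ?B)"
      using pow[of "A - ?B"] by (intro finprod_cong') (auto simp: l'_def)
    ultimately have "finprod G (\<lambda>a. a [^] l' a) A = finprod G (\<lambda>a. a [^] l a) A"
      using finprod_subset_split[OF A(1) B pow[OF order_refl]] by metis
    moreover have "(\<Sum>a\<in>A. \<bar>l' a\<bar>) = int h"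
    proof -
      have split: "(\<Sum>a\<in>A. \<bar>k a\<bar>) = (\<Sum>a\<in>A - ?B. \<bar>k a\<bar>) + (\<bar>k b\<bar> + \<bar>k (inv b)\<bar>)" for k :: "'a \<Rightarrow> int"
        using sum.subset_diff[OF B A(1), of "\<lambda>a. \<bar>k a\<bar>"] False by simp
      have "(\<Sum>a\<in>A - ?B. \<bar>l' a\<bar>) = (\<Sum>a\<in>A - ?B. \<bar>l a\<bar>)"
        by (intro sum.cong) (auto simp: l'_def)
      then show ?thesis
        using weight uv False by (simp add: split) (simp add: l'_def)
    qed
    ultimately show ?thesis by blast
  qed
  then show ?thesis using signed_sumsetI[OF A(1)] by metis
qed

text \<open>
  One more factor from \<open>A\<close> or its inverse changes a single exponent by one. If the exponent moves
  towards zero, then the weight drops to \<open>h - 1\<close> and has to be padded by \<open>2\<close>.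
\<close>

lemma (in comm_group) signed_sumset_mult:
  assumes A: "finite A" "A \<subseteq> carrier G" and b: "b \<in> A" "inv b \<in> A"
    and z: "z \<in> signed_sumset G h A" and y: "y \<in> A \<union> set_inv A"
  shows "z \<otimes> y \<in> signed_sumset G (Suc h) A"
proof -
  obtain l where l: "z = finprod G (\<lambda>a. a [^] (l a :: int)) A" "(\<Sum>a\<in>A. \<bar>l a\<bar>) = int h"
    using z unfolding signed_sumset_def by blast
  obtain a and d :: int where a: "a \<in> A" and d: "d = 1 \<or> d = - 1" and ya: "y = a [^] d"
  proof -
    from y consider "y \<in> A" | a where "a \<in> A" "y = inv a" by (auto simp: SET_INV_def)
    then show thesis
    proof cases
      case 1
      with A show ?thesis by (intro that[of y 1]) auto
    next
      case 2
      with A show ?thesis by (intro that[of a "-1"]) (auto simp: int_pow_neg)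
    qed
  qed
  have aG: "a \<in> carrier G" using A a by blast
  have pow: "(\<lambda>a. a [^] (k a :: int)) \<in> B \<rightarrow> carrier G" if "B \<subseteq> A" for k B
    using A that by auto
  define l' where "l' = l(a := l a + d)"
  have split: "finprod G (\<lambda>a. a [^] k a) A = finprod G (\<lambda>a. a [^] k a) (A - {a}) \<otimes> a [^] k a"
    for k :: "'a \<Rightarrow> int"
    using finprod_subset_split[OF A(1) _ pow[OF order_refl], of "{a}" k] a aG by simp
  have "finprod G (\<lambda>a. a [^] l' a) (A - {a}) = finprod G (\<lambda>a. a [^] l a) (A - {a})"
    using pow[of "A - {a}"] by (intro finprod_cong') (auto simp: l'_def)
  then have "finprod G (\<lambda>a. a [^] l' a) A = z \<otimes> y"
    unfolding split[of l'] l(1) split[of l] ya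
    using aG pow[of "A - {a}" l] by (simp add: l'_def int_pow_mult m_assoc)
  moreover have "finprod G (\<lambda>a. a [^] l' a) A \<in> signed_sumset G (Suc h) A"
  proof -
    have "(\<Sum>x\<in>A - {a}. \<bar>l' x\<bar>) = (\<Sum>x\<in>A - {a}. \<bar>l x\<bar>)"
      by (intro sum.cong) (auto simp: l'_def)
    then have sum: "(\<Sum>x\<in>A. \<bar>l' x\<bar>) = int h - \<bar>l a\<bar> + \<bar>l a + d\<bar>"
      using l(2) sum.remove[OF A(1) a, of "\<lambda>x. \<bar>l x\<bar>"] sum.remove[OF A(1) a, of "\<lambda>x. \<bar>l' x\<bar>"]
      by (simp add: l'_def)
    have "\<bar>l a + d\<bar> = \<bar>l a\<bar> + 1 \<or> \<bar>l a + d\<bar> = \<bar>l a\<bar> - 1" using d by linarith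
    then have "(\<Sum>x\<in>A. \<bar>l' x\<bar>) + 2 * int 0 = int (Suc h)
        \<or> (\<Sum>x\<in>A. \<bar>l' x\<bar>) + 2 * int 1 = int (Suc h)"
      unfolding sum by auto
    then show ?thesis using signed_sumset_pad[OF A b] by blast
  qed
  ultimately show ?thesis by simp
qed

lemma (in comm_group) iterated_set_mult_subset_signed_sumset:
  assumes A: "finite A" "A \<subseteq> carrier G" and b: "b \<in> A" "inv b \<in> A"
  shows "iterated_set_mult G (A \<union> set_inv A) h \<subseteq> signed_sumset G h A"
proof (induction h)
  case 0
  have "finprod G (\<lambda>a. a [^] (0::int)) A \<in> signed_sumset G 0 A"
    by (rule signed_sumsetI) (use A in auto)
  then show ?case by simp
next
  case (Suc h)
  then show ?case
    using signed_sumset_mult[OF A b] by (fastforce simp: set_mult_def)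
qed

lemma (in comm_group) signed_sumset_subset_subgroup:
  assumes H: "subgroup H G" and A: "finite A" "A \<subseteq> H"
  shows "signed_sumset G h A \<subseteq> H"
proof -
  have "finprod G (\<lambda>a. a [^] (l a :: int)) A \<in> H" for l
    using A
  proof (induction A rule: finite_induct)
    case (insert x A)
    then show ?case
      using subgroup.subset[OF H] subgroup_int_pow_closed[OF H]
      by (subst finprod_insert) (auto intro!: subgroup.m_closed[OF H])
  qed (simp add: subgroup.one_closed[OF H])
  then show ?thesis unfolding signed_sumset_def by blast
qed

lemma (in comm_group) finite_signed_sumset:
  assumes "finite A" "A \<subseteq> carrier G"
  shows "finite (signed_sumset G h A)"
proof -
  let ?L = "PiE A (\<lambda>_. {- int h..int h})"
  have "signed_sumset G h A \<subseteq> (\<lambda>l. finprod G (\<lambda>a. a [^] l a) A) ` ?L"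
  proof
    fix z assume "z \<in> signed_sumset G h A"
    then obtain l where l: "z = finprod G (\<lambda>a. a [^] (l a :: int)) A"
      "\<forall>a\<in>A. l a \<in> {- int h..int h}" unfolding signed_sumset_def by blast
    have "z = finprod G (\<lambda>a. a [^] restrict l A a) A"
      unfolding l(1) using assms by (intro finprod_cong') auto
    moreover have "restrict l A \<in> ?L" using l(2) by auto
    ultimately show "z \<in> (\<lambda>l. finprod G (\<lambda>a. a [^] l a) A) ` ?L" by blast
  qed
  moreover have "finite ?L" using assms by (simp add: finite_PiE)
  ultimately show ?thesis by (meson finite_surj)
qed

section \<open>Bounds for admissible sets\<close>

lemma (in comm_group) card_Un_set_inv:
  assumes "finite A" "A \<subseteq> carrier G"
  shows "card (A \<union> set_inv A) + card (A \<inter> set_inv A) = 2 * card A"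
proof -
  have inv: "set_inv A = (\<lambda>a. inv a) ` A" by (auto simp: SET_INV_def)
  have "card (set_inv A) = card A"
    unfolding inv using assms by (intro card_image inj_onI) (metis inv_inv subsetD)
  moreover have "finite (set_inv A)" using assms by (simp add: inv)
  ultimately show ?thesis using card_Un_Int[OF assms(1), of "set_inv A"] by simp
qed

lemma (in comm_group) card_signed_sumset_lower_bounds:
  assumes A: "A \<in> admissible_sets G m s" and s: "0 < s" and h: "0 < h"
  shows "min (min_subgroup_order G) (enat (h * (2 * m - s - 1) + 1)) \<le> enat (card (signed_sumset G h A))"
    and "2 * m - s \<le> card (signed_sumset G h A)"
proof -
  let ?S = "A \<union> set_inv A"
  have A': "A \<subseteq> carrier G" "finite A" "card A = m" "card (A \<inter> set_inv A) = s" "A \<noteq> {}"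
    using A by (auto simp: admissible_sets_def)
  then obtain x where "x \<in> A" "x \<in> set_inv A" using s by (metis Int_iff card.empty equals0I less_irrefl)
  then obtain b where b: "b \<in> A" "inv b \<in> A" by (auto simp: SET_INV_def)
  have S: "finite ?S" "?S \<noteq> {}" "?S \<subseteq> carrier G" "card ?S = 2 * m - s"
    using A' card_Un_set_inv[of A] by (auto simp: SET_INV_def)
  have le: "card (iterated_set_mult G ?S h) \<le> card (signed_sumset G h A)"
    using A' b iterated_set_mult_subset_signed_sumset finite_signed_sumset by (intro card_mono) auto
  show "min (min_subgroup_order G) (enat (h * (2 * m - s - 1) + 1)) \<le> enat (card (signed_sumset G h A))"
    using card_iterated_set_mult[OF S(1-3), of h] le unfolding S(4)
    by (meson enat_ord_simps(1) order_trans)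
  show "2 * m - s \<le> card (signed_sumset G h A)"
    using card_le_card_iterated_set_mult[OF S(1,3) h] le S(4) by simp
qed

section \<open>Sets attaining the bound\<close>

lemma (in comm_group) finprod_int_pow_sum:
  assumes "g \<in> carrier G"
  shows "finprod G (\<lambda>a. g [^] (k a :: int)) A = g [^] (\<Sum>a\<in>A. k a)"
proof (induction A rule: infinite_finite_induct)
  case (insert x A)
  then show ?case using assms by (subst finprod_insert) (auto simp: int_pow_mult)
qed auto

text \<open>
  For \<open>i = 0, \<dots>, N\<close> these are the terms of a progression of ratio \<open>g\<^sup>2\<close> that is symmetric about the
  identity: inversion exchanges the terms \<open>i\<close> and \<open>N - i\<close>.
\<close>

definition centred_power :: "('a, 'b) monoid_scheme \<Rightarrow> 'a \<Rightarrow> nat \<Rightarrow> nat \<Rightarrow> 'a" where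
  "centred_power G g N i = g [^]\<^bsub>G\<^esub> (2 * int i - int N)"

text \<open>
  A factor \<open>g\<^sup>2\<^sup>e\<^sup>-\<^sup>N\<close> with a negative exponent is the term \<open>N - e\<close> taken with the opposite sign. So the
  product is one of \<open>h\<close> terms of the progression, and multiplying terms adds both their indices
  and their lengths.
\<close>

lemma (in comm_group) signed_sumset_centred_powers:
  assumes g: "g \<in> carrier G" and A: "finite A" "A \<subseteq> centred_power G g N ` {..N}"
  shows "signed_sumset G h A \<subseteq> centred_power G g (h * N) ` {..h * N}"
proof
  fix z assume "z \<in> signed_sumset G h A"
  then obtain l where l: "z = finprod G (\<lambda>a. a [^] (l a :: int)) A" "(\<Sum>a\<in>A. \<bar>l a\<bar>) = int h"
    unfolding signed_sumset_def by blast
  have "\<forall>a\<in>A. \<exists>i\<le>N. a = g [^] (2 * int i - int N)"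
    using A by (auto simp: centred_power_def)
  then obtain e where e: "\<And>a. a \<in> A \<Longrightarrow> e a \<le> N" "\<And>a. a \<in> A \<Longrightarrow> a = g [^] (2 * int (e a) - int N)"
    by metis
  \<comment> \<open>\<open>t a\<close> is the index contributed by the factor \<open>a [^] l a\<close>, a product of \<open>\<bar>l a\<bar>\<close> terms.\<close>
  define t where "t a = (if l a \<ge> 0 then e a else N - e a) * nat \<bar>l a\<bar>" for a
  have t: "(2 * int (e a) - int N) * l a = 2 * int (t a) - int N * \<bar>l a\<bar>" if "a \<in> A" for a
    using e(1)[OF that] by (auto simp: t_def of_nat_diff algebra_simps)
  have "z = finprod G (\<lambda>a. g [^] (2 * int (t a) - int N * \<bar>l a\<bar>)) A"
    unfolding l(1)
  proof (rule finprod_cong')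
    fix a assume a: "a \<in> A"
    have "a [^] l a = (g [^] (2 * int (e a) - int N)) [^] l a"
      using e(2)[OF a] by simp
    also have "\<dots> = g [^] (2 * int (t a) - int N * \<bar>l a\<bar>)"
      using g by (simp only: int_pow_pow t[OF a])
    finally show "a [^] l a = g [^] (2 * int (t a) - int N * \<bar>l a\<bar>)" .
  qed (use g in auto)
  also have "\<dots> = g [^] (\<Sum>a\<in>A. 2 * int (t a) - int N * \<bar>l a\<bar>)"
    by (rule finprod_int_pow_sum[OF g])
  also have "(\<Sum>a\<in>A. 2 * int (t a) - int N * \<bar>l a\<bar>) = 2 * (\<Sum>a\<in>A. int (t a)) - int N * int h"
    by (simp add: sum_subtractf sum_distrib_left[symmetric] l(2))
  finally have "z = centred_power G g (h * N) (\<Sum>a\<in>A. t a)"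
    by (simp add: centred_power_def mult.commute)
  moreover have "(\<Sum>a\<in>A. t a) \<le> h * N"
  proof -
    have "(\<Sum>a\<in>A. t a) \<le> (\<Sum>a\<in>A. N * nat \<bar>l a\<bar>)"
      using e(1) by (intro sum_mono) (auto simp: t_def intro!: mult_right_mono)
    then have "int (\<Sum>a\<in>A. t a) \<le> int (\<Sum>a\<in>A. N * nat \<bar>l a\<bar>)"
      by (simp only: of_nat_le_iff)
    also have "\<dots> = int N * (\<Sum>a\<in>A. \<bar>l a\<bar>)"
      by (simp add: sum_distrib_left)
    also have "\<dots> = int (h * N)" by (simp add: l(2))
    finally show ?thesis by (simp only: of_nat_le_iff)
  qed
  ultimately show "z \<in> centred_power G g (h * N) ` {..h * N}" by blast
qed

text \<open>
  A coincidence among the terms makes \<open>g\<^sup>2\<close> an element of order at most \<open>N\<close>; if \<open>g\<^sup>2\<close> is not the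
  identity, this contradicts \<open>N < p(G)\<close>.
\<close>

lemma (in comm_group) inj_on_centred_power:
  assumes g: "g \<in> carrier G" "g [^] (2::nat) \<noteq> \<one>" and N: "enat N < min_subgroup_order G"
  shows "inj_on (centred_power G g N) {..N}"
proof (rule linorder_inj_onI)
  fix i j assume ij: "i < j" "i \<in> {..N}" "j \<in> {..N}"
  show "centred_power G g N i \<noteq> centred_power G g N j"
  proof
    assume eq: "centred_power G g N i = centred_power G g N j"
    have "g [^] (2 * int j - int N) = g [^] ((2 * int i - int N) + int (2 * (j - i)))"
      using ij by (simp add: of_nat_diff algebra_simps)
    also have "\<dots> = g [^] (2 * int i - int N) \<otimes> g [^] (2 * (j - i))"
      using g by (simp only: int_pow_mult int_pow_int)
    finally have "g [^] (2 * (j - i)) = \<one>"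
      using eq g by (simp add: centred_power_def)
    then have "(g [^] (2::nat)) [^] (j - i) = \<one>"
      using g by (simp add: nat_pow_pow)
    then have "min_subgroup_order G \<le> enat (j - i)"
      using g ij by (intro min_subgroup_order_le_exponent[of "g [^] (2::nat)"]) auto
    also have "\<dots> \<le> enat N" using ij by simp
    finally show False using N by simp
  qed
qed auto

text \<open>
  Inversion carries the first \<open>m\<close> of the \<open>2m - s\<close> terms to the last \<open>m\<close>, and the two blocks overlap
  in the indices from \<open>m - s\<close> to \<open>m - 1\<close>.
\<close>

lemma (in comm_group) centred_powers_admissible:
  assumes g: "g \<in> carrier G" and ms: "0 < s" "s \<le> m"
    and inj: "inj_on (centred_power G g (2 * m - s - 1)) {..2 * m - s - 1}"
  shows "centred_power G g (2 * m - s - 1) ` {..<m} \<in> admissible_sets G m s"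
proof -
  define N where "N = 2 * m - s - 1"
  let ?f = "centred_power G g N"
  note inj = inj[folded N_def]
  have "inv (?f i) = ?f (N - i)" if "i \<le> N" for i
    using g that by (simp add: centred_power_def int_pow_neg[symmetric] of_nat_diff)
  then have "set_inv (?f ` {..<m}) = (\<lambda>i. ?f (N - i)) ` {..<m}"
    using ms by (auto simp: SET_INV_def N_def)
  also have "\<dots> = ?f ` ((\<lambda>i. N - i) ` {..<m})" by (simp add: image_image)
  also have "(\<lambda>i. N - i) ` {..<m} = {m - s..N}"
  proof safe
    fix k assume "k \<in> {m - s..N}"
    then show "k \<in> (\<lambda>i. N - i) ` {..<m}"
      using ms by (intro image_eqI[of _ _ "N - k"]) (auto simp: N_def)
  qed (use ms in \<open>auto simp: N_def\<close>)
  finally have "set_inv (?f ` {..<m}) = ?f ` {m - s..N}" .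
  then have "?f ` {..<m} \<inter> set_inv (?f ` {..<m}) = ?f ` ({..<m} \<inter> {m - s..N})"
    using ms by (simp only:) (rule inj_on_image_Int[OF inj, symmetric], auto simp: N_def)
  moreover have "{..<m} \<inter> {m - s..N} = {m - s..<m}" using ms by (auto simp: N_def)
  moreover have "{m - s..<m} \<subseteq> {..N}" "{..<m} \<subseteq> {..N}" using ms by (auto simp: N_def)
  then have "card (?f ` {m - s..<m}) = card {m - s..<m}" "card (?f ` {..<m}) = card {..<m}"
    using inj by (simp_all only: card_image inj_on_subset)
  ultimately show ?thesis
    using g ms by (auto simp: admissible_sets_def N_def centred_power_def)
qed

text \<open>
  If \<open>p(G)\<close> is finite, \<open>g\<close> is taken from a subgroup of order \<open>p(G)\<close>, which then contains the whole
  signed sumset; otherwise any \<open>g\<close> other than the identity will do. In the trivial group the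
  progression has a single term.
\<close>

lemma (in comm_group) exists_admissible_attaining_bound:
  assumes adm: "admissible_sets G m s \<noteq> {}" and ms: "0 < s" "s \<le> m" and h: "0 < h"
    and small: "enat (2 * m - s) \<le> min_subgroup_order G"
  shows "\<exists>A\<in>admissible_sets G m s.
    enat (card (signed_sumset G h A)) \<le> min (min_subgroup_order G) (enat (h * (2 * m - s - 1) + 1))"
proof -
  define N where "N = 2 * m - s - 1"
  have N: "enat N < min_subgroup_order G"
  proof -
    have "enat N < enat (2 * m - s)" using ms by (simp add: N_def)
    from this small show ?thesis by (rule order_less_le_trans)
  qed
  have progression: ?thesis
    if g: "g \<in> carrier G" and inj: "inj_on (centred_power G g N) {..N}"
      and in_min: "min_subgroup_order G \<noteq> \<infinity> \<Longrightarrow> \<exists>H. subgroup H G \<and> finite H \<and> g \<in> H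
        \<and> min_subgroup_order G = enat (card H)" for g
  proof (rule bexI)
    let ?A = "centred_power G g N ` {..<m}"
    show "?A \<in> admissible_sets G m s"
      using centred_powers_admissible[OF g ms] inj by (simp add: N_def)
    have "?A \<subseteq> centred_power G g N ` {..N}" using ms by (auto simp: N_def)
    then have sub: "signed_sumset G h ?A \<subseteq> centred_power G g (h * N) ` {..h * N}"
      using g by (intro signed_sumset_centred_powers) auto
    have "card (signed_sumset G h ?A) \<le> card (centred_power G g (h * N) ` {..h * N})"
      using sub by (intro card_mono) auto
    also have "\<dots> \<le> card {..h * N}" by (intro card_image_le) simp
    finally have "card (signed_sumset G h ?A) \<le> h * N + 1" by simp
    moreover have "enat (card (signed_sumset G h ?A)) \<le> min_subgroup_order G"
    proof (cases "min_subgroup_order G = \<infinity>")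
      case False
      then obtain H where H: "subgroup H G" "finite H" "g \<in> H" "min_subgroup_order G = enat (card H)"
        using in_min by blast
      have "?A \<subseteq> H" using subgroup_int_pow_closed[OF H(1,3)] by (auto simp: centred_power_def)
      then have "signed_sumset G h ?A \<subseteq> H" by (intro signed_sumset_subset_subgroup[OF H(1)]) auto
      then show ?thesis using H by (simp add: card_mono)
    qed simp
    ultimately show "enat (card (signed_sumset G h ?A))
        \<le> min (min_subgroup_order G) (enat (h * (2 * m - s - 1) + 1))"
      by (simp add: N_def)
  qed
  obtain g where g: "g \<in> carrier G" "N \<noteq> 0 \<Longrightarrow> g \<noteq> \<one>"
    and gH: "min_subgroup_order G \<noteq> \<infinity> \<Longrightarrow> \<exists>H. subgroup H G \<and> finite H \<and> g \<in> H
        \<and> min_subgroup_order G = enat (card H)"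
  proof (cases "min_subgroup_order G = \<infinity>")
    case True
    obtain A where A: "A \<subseteq> carrier G" "card A = m"
      using adm by (auto simp: admissible_sets_def)
    have "\<exists>g\<in>carrier G. N \<noteq> 0 \<longrightarrow> g \<noteq> \<one>"
    proof (rule ccontr)
      assume "\<not> ?thesis"
      then have "N \<noteq> 0" "A \<subseteq> {\<one>}" using A by auto
      then have "m \<le> 1" using A(2) card_mono[of "{\<one>}" A] by simp
      with \<open>N \<noteq> 0\<close> ms show False by (simp add: N_def)
    qed
    with True that show thesis by blast
  next
    case False
    then obtain H where H: "subgroup H G" "finite H" "H \<noteq> {\<one>}" "min_subgroup_order G = enat (card H)"
      by (rule min_subgroup_order_attained)
    then obtain g where "g \<in> H" "g \<noteq> \<one>" using subgroup.one_closed[OF H(1)] by blast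
    with H that[of g] subgroup.subset[OF H(1)] show thesis by blast
  qed
  \<comment> \<open>A progression with a single term is injective for every \<open>g\<close>; only two or more terms need
    \<open>g\<^sup>2\<close> to differ from the identity, which \<open>p(G) > 2\<close> guarantees.\<close>
  consider "N = 0" | "N \<noteq> 0" "2 < min_subgroup_order G" | "N \<noteq> 0" "min_subgroup_order G = 2"
    using two_le_min_subgroup_order by fastforce
  then show ?thesis
  proof cases
    case 1
    then show ?thesis by (intro progression[OF g(1) _ gH]) auto
  next
    case 2
    have "g [^] (2::nat) \<noteq> \<one>"
      using min_subgroup_order_le_exponent[of g 2] 2 g by (auto simp: numeral_eq_enat)
    then show ?thesis by (intro progression[OF g(1) inj_on_centred_power[OF g(1) _ N] gH])
  next
    case 3
    then have "2 * m - s \<le> 2" using small by (simp add: numeral_eq_enat)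
    then have "2 * m = s + 2" using 3 ms by (auto simp: N_def)
    then have m: "m = 2" "s = 2" using ms by presburger+
    obtain H where H: "subgroup H G" "finite H" "card H = 2"
      using gH 3 by (auto simp: numeral_eq_enat)
    have "x \<in> set_inv H" if "x \<in> H" for x
      using that subgroup.m_inv_closed[OF H(1)] subgroup.mem_carrier[OF H(1)]
      by (auto simp: SET_INV_def intro!: bexI[of _ "inv x"])
    then have "set_inv H = H"
      using subgroup.m_inv_closed[OF H(1)] by (auto simp: SET_INV_def)
    then have "H \<in> admissible_sets G m s"
      using H m subgroup.subset[OF H(1)] by (auto simp: admissible_sets_def)
    moreover have "card (signed_sumset G h H) \<le> 2"
      using signed_sumset_subset_subgroup[OF H(1,2), of h] card_mono[OF H(2)] H(3) by fastforce
    ultimately show ?thesis using 3 m h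
      by (intro bexI[of _ H]) (auto simp: numeral_eq_enat min_def)
  qed
qed

section \<open>The minimal size of a signed sumset\<close>

theorem theorem1p4:
  fixes G :: "('a, 'b) monoid_scheme" and h m s :: nat
  assumes "comm_group G"
    and "0 < h" and "0 < m" and "0 < s" and "s \<le> m"
    and "admissible_sets G m s \<noteq> {}"
  shows "ereal (real (rho_signed G s m h)) \<ge>
           min (ereal_of_enat (min_subgroup_order G))
               (ereal (2 * real h * real m - real h * real s - real h + 1)) \<and>
         (ereal (real (rho_signed G s m h)) =
           min (ereal_of_enat (min_subgroup_order G))
               (ereal (2 * real h * real m - real h * real s - real h + 1))
          \<longleftrightarrow> ereal (real m) \<le> (ereal (real s) + ereal_of_enat (min_subgroup_order G)) / 2)"
proof -
  interpret comm_group G by fact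
  let ?P = "min_subgroup_order G" and ?n = "2 * m - s" and ?r = "rho_signed G s m h"
  let ?N = "h * (?n - 1) + 1"
  have bound: "2 * real h * real m - real h * real s - real h + 1 = real ?N"
  proof -
    have "real (?n - 1) = 2 * real m - real s - 1"
      using assms(4,5) by (simp add: of_nat_diff)
    then have "real ?N = real h * (2 * real m - real s - 1) + 1" by simp
    then show ?thesis by (simp only: algebra_simps)
  qed
  have min_eq: "min (ereal_of_enat a) (ereal (real b)) = ereal_of_enat (min a (enat b))" for a b
    by (cases a) (auto simp: min_def)
  have half: "ereal (real m) \<le> (ereal (real s) + ereal_of_enat ?P) / 2 \<longleftrightarrow> enat ?n \<le> ?P"
    using assms(5) by (cases ?P) (auto simp: field_simps)
  let ?K = "(\<lambda>A. card (signed_sumset G h A)) ` admissible_sets G m s"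
  have "?r \<in> ?K" unfolding rho_signed_def using assms(6) by (intro Inf_nat_def1) simp
  then obtain A where A: "A \<in> admissible_sets G m s" "?r = card (signed_sumset G h A)" by blast
  have lower: "min ?P (enat ?N) \<le> enat ?r" "?n \<le> ?r"
    using card_signed_sumset_lower_bounds[OF A(1) assms(4,2)] A(2) by simp_all
  have "enat ?r = min ?P (enat ?N) \<longleftrightarrow> enat ?n \<le> ?P"
  proof
    assume "enat ?r = min ?P (enat ?N)"
    then have "enat ?r \<le> ?P" by simp
    moreover have "enat ?n \<le> enat ?r" using lower(2) by simp
    ultimately show "enat ?n \<le> ?P" by (rule order_trans[rotated])
  next
    assume "enat ?n \<le> ?P"
    then obtain B where B: "B \<in> admissible_sets G m s"
      "enat (card (signed_sumset G h B)) \<le> min ?P (enat ?N)"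
      using exists_admissible_attaining_bound assms by blast
    have "?r \<le> card (signed_sumset G h B)"
      unfolding rho_signed_def using B(1) by (intro cINF_lower) auto
    then have "enat ?r \<le> enat (card (signed_sumset G h B))" by simp
    with B(2) lower(1) show "enat ?r = min ?P (enat ?N)" by (meson order_antisym order_trans)
  qed
  moreover have "ereal (real ?r) = ereal_of_enat (enat ?r)" by simp
  moreover have "ereal_of_enat a = ereal_of_enat b \<longleftrightarrow> a = b" for a b
    by (metis ereal_of_enat_le_iff order_antisym order_refl)
  ultimately show ?thesis
    unfolding bound min_eq half using lower(1) by (simp del: ereal_of_enat_simps)
qed

end
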